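(* Let $f:\mathbb{R}^d\to\mathbb{R}$ be differentiable and symmetrically $(L_0,L_1)$-smooth with $L_0,L_1\ge0$, and let $\nu$ be the real number with $\nu=e^{-\nu}$. Then: 1. For $f_*:=\inf_{x\in\mathbb{R}^d}f(x)$ and arbitrary $x\in\mathbb{R}^d$, $$\frac{\nu\|\nabla f(x)\|^2}{2(L_0+L_1\|\nabla f(x)\|)}\le f(x)-f_*.$$ 2. If additionally $f$ is convex, then for any $x,y\in\mathbb{R}^d$ such that $L_1\|x-y\|\exp(L_1\|x-y\|)\le1$ we have $$\frac{\nu\|\nabla f(x)-\nabla f(y)\|^2}{2(L_0+L_1\|\nabla f(y)\|)}\le f(y)-f(x)-\langle\nabla f(x),y-x\rangle$$ and $$\frac{\nu\|\nabla f(x)-\nabla f(y)\|^2}{2(L_0+L_1\|\nabla f(y)\|)}+\frac{\nu\|\nabla f(x)-\nabla f(y)\|^2}{2(L_0+L_1\|\nabla f(x)\|)}\le\langle\nabla f(x)-\nabla f(y),x-y\rangle.$$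
   Context: $\|\cdot\|$ is the Euclidean norm. A differentiable $f:\mathbb{R}^d\to\mathbb{R}$ is convex if $f(y)\ge f(x)+\langle\nabla f(x),y-x\rangle$ for all $x,y$. It is symmetrically $(L_0,L_1)$-smooth if for all $x,y\in\mathbb{R}^d$ $$\|\nabla f(x)-\nabla f(y)\|\le\Big(L_0+L_1\sup_{u\in[x,y]}\|\nabla f(u)\|\Big)\|x-y\|,$$ where $[x,y]$ is the line segment between $x$ and $y$. Convention: $0/0=0$ (only relevant when $L_0=0$ and a gradient vanishes); if $f_*=-\infty$ the right-hand side in item 1 is $+\infty$. *)

theory Defs
  imports "HOL-Analysis.Analysis"
begin

definition grad :: "('a::real_inner \<Rightarrow> real) \<Rightarrow> 'a \<Rightarrow> 'a"
  where "grad f x = (THE D. GDERIV f x :> D)"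

lemma GDERIV_grad:
  fixes f :: "'a::euclidean_space \<Rightarrow> real"
  assumes "f differentiable (at x)"
  shows "GDERIV f x :> grad f x"
proof -
  obtain f' where f': "(f has_derivative f') (at x)"
    using assms by (auto simp: differentiable_def)
  then interpret f': bounded_linear f'
    by (rule has_derivative_bounded_linear)
  define D where "D = (\<Sum>b\<in>Basis. f' b *\<^sub>R b)"
  have "f' = (\<lambda>h. inner h D)"
  proof
    fix h
    have "f' h = f' (\<Sum>b\<in>Basis. inner h b *\<^sub>R b)"
      by (simp add: euclidean_representation)
    also have "\<dots> = inner h D"
      by (simp add: D_def f'.sum f'.scaleR inner_sum_right mult.commute)
    finally show "f' h = inner h D" .
  qed
  then have D: "GDERIV f x :> D"
    unfolding gderiv_def by (rule subst) (rule f')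
  have "E = D" if "GDERIV f x :> E" for E
  proof -
    have "(\<lambda>h. inner h E) = (\<lambda>h. inner h D)"
      using that D unfolding gderiv_def by (rule has_derivative_unique)
    then have "\<forall>h. inner h E = inner h D"
      by (rule fun_eq_iff[THEN iffD1])
    then show ?thesis
      by (rule vector_eq_ldot[THEN iffD1])
  qed
  with D show ?thesis
    unfolding grad_def by (rule theI)
qed

(* First-order convexity; only meaningful for differentiable f. *)
definition convex_fo :: "('a::real_inner \<Rightarrow> real) \<Rightarrow> bool"
  where "convex_fo f \<longleftrightarrow> (\<forall>x y. f y \<ge> f x + inner (grad f x) (y - x))"

(* The gradient of a differentiable function may be unbounded on a segment, so the supremum is
   taken in ereal, where it is \<infinity> in that case (and 0 * \<infinity> = 0, so that L1 = 0 is ordinary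
   L0-smoothness).  On type real, Sup of an unbounded set would be an unspecified number. *)
definition symmetrically_smooth :: "real \<Rightarrow> real \<Rightarrow> ('a::real_inner \<Rightarrow> real) \<Rightarrow> bool"
  where "symmetrically_smooth L0 L1 f \<longleftrightarrow>
    (\<forall>x y. ereal (norm (grad f x - grad f y)) \<le>
       (ereal L0 + ereal L1 * (SUP u\<in>closed_segment x y. ereal (norm (grad f u))))
         * ereal (norm (x - y)))"

(* Quotient in ereal: 0 / 0 = 0, but a / 0 = \<infinity> for a > 0, so a vanishing denominator
   does not make an upper bound on the quotient trivially true. *)
definition equot :: "real \<Rightarrow> real \<Rightarrow> ereal"
  where "equot a b = ereal a / ereal b"

lemma equot_0_0: "equot 0 0 = 0"
  by (simp add: equot_def)

lemma equot_pos_0: "a > 0 \<Longrightarrow> equot a 0 = \<infinity>"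
  by (simp add: equot_def divide_ereal_def)

lemma equot_real: "b \<noteq> 0 \<Longrightarrow> equot a b = ereal (a / b)"
  by (simp add: equot_def)

end

theory Submission
  imports Defs
begin

text \<open>Smoothness says that \<open>h = L0 + L1 * norm (grad f _)\<close> has Lipschitz constant at most
  \<open>L1 * B\<close> on any segment where \<open>h \<le> B\<close>, so \<open>h\<close> grows at most exponentially along segments on
  which it is bounded. A Baire category argument, using the differentiability of \<open>f\<close>, shows that
  \<open>h\<close> is locally bounded, hence bounded on every segment. The exponential bound yields a descent
  inequality, and both estimates follow from a single gradient step: for \<open>f\<close> itself, and for \<open>f\<close>
  minus its linearisation at \<open>x\<close>.\<close>

section \<open>Exponential growth along segments\<close>

text \<open>The bound \<open>B\<close> stands in for a supremum over the segment: a real supremum is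
  unspecified where \<open>h\<close> is unbounded, whereas here the condition is then
  vacuous.\<close>

definition relatively_lipschitz :: "real \<Rightarrow> ('a::real_normed_vector \<Rightarrow> real) \<Rightarrow> bool"
  where "relatively_lipschitz L h \<longleftrightarrow>
    (\<forall>x y B. (\<forall>u\<in>closed_segment x y. h u \<le> B) \<longrightarrow> \<bar>h x - h y\<bar> \<le> L * B * norm (x - y))"

text \<open>A discrete Gronwall argument: with \<open>N > c\<close> equal pieces, the running
  supremum grows by at most the factor \<open>1 / (1 - c / N)\<close> per piece, and
  \<open>N\<close> tends to infinity. Boundedness makes this supremum a genuine number.\<close>

lemma exp_growth_unit_interval:
  fixes g :: "real \<Rightarrow> real"
  assumes "0 \<le> c"
    and nonneg: "\<And>t. t \<in> {0..1} \<Longrightarrow> 0 \<le> g t"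
    and lip: "\<And>s t B. 0 \<le> s \<Longrightarrow> s \<le> t \<Longrightarrow> t \<le> 1 \<Longrightarrow> (\<And>u. u \<in> {s..t} \<Longrightarrow> g u \<le> B)
                \<Longrightarrow> \<bar>g s - g t\<bar> \<le> c * B * (t - s)"
    and bdd: "bdd_above (g ` {0..1})"
  shows "g 1 \<le> g 0 * exp c"
proof -
  have step: "g 1 * (1 - c / real N) ^ N \<le> g 0" if N: "N > 0" "c \<le> real N" for N
  proof -
    define q where "q = 1 - c / real N"
    have q: "0 \<le> q" using N by (simp add: q_def)
    \<comment> \<open>The product form avoids dividing by \<open>q\<close>, which is zero when
      \<open>c = N\<close>.\<close>
    have "\<forall>u\<in>{0..real k / real N}. g u * q ^ k \<le> g 0" if "k \<le> N" for k
      using that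
    proof (induction k)
      case 0
      then show ?case by simp
    next
      case (Suc k)
      define p where "p = real k / real N"
      define r where "r = real (Suc k) / real N"
      have pr: "0 \<le> p" "p \<le> r" "r \<le> 1" "r - p = 1 / real N"
        using N Suc.prems by (auto simp: p_def r_def field_simps)
      have IH: "\<And>u. u \<in> {0..p} \<Longrightarrow> g u * q ^ k \<le> g 0"
        using Suc by (auto simp: p_def)
      define M where "M = Sup (g ` {0..r})"
      have bddr: "bdd_above (g ` {0..r})"
        using pr by (intro bdd_above_mono[OF bdd]) auto
      have leM: "g u \<le> M" if "u \<in> {0..r}" for u
        unfolding M_def using that by (intro cSup_upper bddr) auto
      have M0: "0 \<le> M"
        using leM[of 0] nonneg[of 0] pr by auto
      have v: "g v * q ^ k \<le> g 0 + c / real N * M * q ^ k" if v: "v \<in> {0..r}" for v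
      proof (cases "v \<le> p")
        case True
        then have "g v * q ^ k \<le> g 0" using IH v by auto
        moreover have "0 \<le> c / real N * M * q ^ k"
          using M0 q \<open>0 \<le> c\<close> by simp
        ultimately show ?thesis by linarith
      next
        case False
        have "\<bar>g p - g v\<bar> \<le> c * M * (v - p)"
          using False v pr by (intro lip leM) auto
        also have "\<dots> \<le> c * M * (1 / real N)"
          using v pr M0 \<open>0 \<le> c\<close> by (intro mult_left_mono) auto
        finally have "g v \<le> g p + c / real N * M" by (simp add: abs_le_iff)
        then have "g v * q ^ k \<le> (g p + c / real N * M) * q ^ k"
          using q by (intro mult_right_mono) auto
        also have "\<dots> \<le> g 0 + c / real N * M * q ^ k"
          using IH[of p] pr by (simp add: distrib_right)
        finally show ?thesis .
      qed
      have Mq: "M * q ^ Suc k \<le> g 0"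
      proof (cases "q = 0")
        case True
        then show ?thesis using nonneg[of 0] by simp
      next
        case False
        with q have qk: "0 < q ^ k" by simp
        \<comment> \<open>\<open>M\<close> occurs on both sides, since the Lipschitz constant on the
          new piece involves the supremum over that piece too. Collecting both terms produces the
          extra factor \<open>q\<close>.\<close>
        have "M \<le> (g 0 + c / real N * M * q ^ k) / q ^ k"
          using v qk pr by (subst M_def, intro cSup_least) (auto simp: pos_le_divide_eq)
        then have "M * q ^ k \<le> g 0 + c / real N * M * q ^ k"
          using qk by (simp add: pos_le_divide_eq)
        then show ?thesis by (simp add: q_def algebra_simps)
      qed
      have "g u * q ^ Suc k \<le> g 0" if "u \<in> {0..r}" for u
      proof -
        have "g u * q ^ Suc k \<le> M * q ^ Suc k"
          using leM[OF that] q by (intro mult_right_mono) auto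
        with Mq show ?thesis by simp
      qed
      then show ?case by (simp add: r_def)
    qed
    from this[of N] N show ?thesis by (auto simp: q_def)
  qed
  have "(\<lambda>N. g 1 * (1 + (- c) / real N) ^ N) \<longlonglongrightarrow> g 1 * exp (- c)"
    by (intro tendsto_mult_left tendsto_exp_limit_sequentially)
  moreover have "\<forall>\<^sub>F N in sequentially. g 1 * (1 + (- c) / real N) ^ N \<le> g 0"
    using eventually_ge_at_top[of "nat \<lceil>c\<rceil> + 1"]
  proof eventually_elim
    case (elim N)
    then have "N > 0" "c \<le> real N" by linarith+
    from step[OF this] show ?case by simp
  qed
  ultimately have "g 1 * exp (- c) \<le> g 0"
    by (intro tendsto_upperbound[of _ _ sequentially]) auto
  then show ?thesis
    by (simp add: exp_minus field_simps)
qed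

text \<open>Parametrising the segment reduces this to the unit interval with
  \<open>c = L * norm (x - y)\<close>.\<close>

lemma relatively_lipschitz_exp_growth:
  fixes h :: "'a::real_normed_vector \<Rightarrow> real"
  assumes lip: "relatively_lipschitz L h" and "0 \<le> L" and nonneg: "\<And>x. 0 \<le> h x"
    and bdd: "bdd_above (h ` closed_segment x y)"
  shows "h y \<le> h x * exp (L * norm (x - y))"
proof -
  define p where "p t = x + t *\<^sub>R (y - x)" for t
  have seg: "closed_segment (p s) (p t) = p ` {s..t}" if "s \<le> t" for s t
  proof -
    have "closed_segment (p s) (p t) = (\<lambda>v. x + v) ` (\<lambda>t. t *\<^sub>R (y - x)) ` closed_segment s t"
      unfolding p_def
      by (simp add: closed_segment_translation closed_segment_linear_image[of "\<lambda>t. t *\<^sub>R (y - x)"]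
          linear_iff scaleR_left_distrib)
    then show ?thesis
      using that by (simp add: p_def image_image closed_segment_eq_real_ivl)
  qed
  have "h (p 1) \<le> h (p 0) * exp (L * norm (x - y))"
  proof (rule exp_growth_unit_interval)
    show "bdd_above ((\<lambda>t. h (p t)) ` {0..1})"
      using bdd seg[of 0 1] by (simp add: image_image p_def)
    show "\<bar>h (p s) - h (p t)\<bar> \<le> L * norm (x - y) * B * (t - s)"
      if "s \<le> t" and "\<And>u. u \<in> {s..t} \<Longrightarrow> h (p u) \<le> B" for s t B
    proof -
      have "\<bar>h (p s) - h (p t)\<bar> \<le> L * B * norm (p s - p t)"
        using lip that unfolding relatively_lipschitz_def by (auto simp: seg)
      also have "p s - p t = (t - s) *\<^sub>R (x - y)"
        by (simp add: p_def algebra_simps)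
      finally show ?thesis
        using \<open>s \<le> t\<close> by (simp add: mult_ac)
    qed
  qed (use nonneg \<open>0 \<le> L\<close> in auto)
  then show ?thesis by (simp add: p_def)
qed

section \<open>Local boundedness by Baire category\<close>

definition locally_bdd_above :: "('a::metric_space \<Rightarrow> real) \<Rightarrow> 'a \<Rightarrow> bool"
  where "locally_bdd_above h x \<longleftrightarrow> (\<exists>r>0. bdd_above (h ` ball x r))"

lemma open_locally_bdd_above: "open {x. locally_bdd_above h x}"
proof (rule openI)
  fix x assume "x \<in> {x. locally_bdd_above h x}"
  then obtain r where r: "r > 0" "bdd_above (h ` ball x r)"
    by (auto simp: locally_bdd_above_def)
  have "locally_bdd_above h z" if z: "z \<in> ball x r" for z
  proof -
    obtain e where "e > 0" "ball z e \<subseteq> ball x r"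
      using openE[OF open_ball z] by blast
    then show ?thesis
      using r(2) by (meson bdd_above_mono image_mono locally_bdd_above_def)
  qed
  with r show "\<exists>e>0. ball x e \<subseteq> {x. locally_bdd_above h x}" by auto
qed

lemma compact_bdd_above:
  assumes "compact S" and "\<And>x. x \<in> S \<Longrightarrow> locally_bdd_above h x"
  shows "bdd_above (h ` S)"
proof -
  obtain r where r: "\<And>x. x \<in> S \<Longrightarrow> r x > 0 \<and> bdd_above (h ` ball x (r x))"
    using assms(2) unfolding locally_bdd_above_def by metis
  obtain D where D: "D \<subseteq> S" "finite D" "S \<subseteq> (\<Union>x\<in>D. ball x (r x))"
    by (rule compactE_image[OF assms(1), of S "\<lambda>x. ball x (r x)"]) (use r in force)+
  have "bdd_above (\<Union>x\<in>D. h ` ball x (r x))"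
    using D r by (subst bdd_above_UN) auto
  then show ?thesis
    by (rule bdd_above_mono) (simp add: D(3) image_mono flip: image_UN)
qed

text \<open>By Baire's theorem, the restriction of \<open>h\<close> to the closed set where local boundedness fails
  is bounded near some point; exponential growth carries this bound into the complement.\<close>

lemma relatively_lipschitz_locally_bdd_above:
  fixes h :: "'a::euclidean_space \<Rightarrow> real" and C :: "nat \<Rightarrow> 'a set"
  assumes lip: "relatively_lipschitz L h" and L: "0 \<le> L" and nonneg: "\<And>x. 0 \<le> h x"
    and C: "\<And>n. closed (C n)" "(\<Union>n. C n) = UNIV" "\<And>n. bdd_above (h ` C n)"
  shows "locally_bdd_above h x"
proof (rule ccontr)
  define K where "K = - {x. locally_bdd_above h x}"
  have K: "closed K" unfolding K_def using open_locally_bdd_above by auto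
  assume "\<not> locally_bdd_above h x"
  then have xK: "x \<in> K" by (simp add: K_def)
  \<comment> \<open>The sets \<open>K - C n\<close> are relatively open in \<open>K\<close> and have
    empty intersection, since the \<open>C n\<close> cover the space; as \<open>K\<close> is
    nonempty, they cannot all be dense in it.\<close>
  have "\<exists>n. \<not> K \<subseteq> closure (K - C n)"
  proof (rule ccontr)
    assume "\<not> ?thesis"
    then have "K \<subseteq> closure (\<Inter> (range (\<lambda>n. K - C n)))"
      using C(1) by (intro Baire[OF K])
        (auto simp: Diff_eq intro!: openin_open_Int open_Compl)
    moreover have "\<Inter> (range (\<lambda>n. K - C n)) = {}" using C(2) by auto
    ultimately have "K \<subseteq> closure {}" by (simp only:)
    then show False using xK by simp
  qed
  then obtain n p where p: "p \<in> K" "p \<notin> closure (K - C n)" by auto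
  \<comment> \<open>Near \<open>p\<close> all of \<open>K\<close> lies in the single set
    \<open>C n\<close>, so one \<open>M\<close> bounds \<open>h\<close> there on
    \<open>K\<close>.\<close>
  then obtain r where r: "r > 0" and KC: "\<And>z. z \<in> K \<Longrightarrow> z \<in> ball p r \<Longrightarrow> z \<in> C n"
    by (auto simp: closure_approachable dist_commute)
  obtain M where M: "\<And>z. z \<in> C n \<Longrightarrow> h z \<le> M" using C(3)[of n] by (auto simp: bdd_above_def)
  have "0 \<le> M" using M[OF KC, of p] nonneg[of p] p(1) r by simp
  have "h s \<le> M * exp (L * r)" if s: "s \<in> ball p r" for s
  proof -
    define S where "S = K \<inter> closed_segment p s"
    have "closed_segment p s \<subseteq> ball p r"
      using s r by (intro closed_segment_subset) auto
    then have S: "closed S" "S \<noteq> {}" "S \<subseteq> ball p r"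
      using K p(1) by (auto simp: S_def)
    \<comment> \<open>The last point of \<open>K\<close> on the way from \<open>p\<close> to
      \<open>s\<close>: all later points up to \<open>s\<close> lie outside
      \<open>K\<close>.\<close>
    obtain a where a: "a \<in> S" "\<And>z. z \<in> S \<Longrightarrow> dist s a \<le> dist s z"
      using distance_attains_inf[OF S(1,2), of s] by blast
    have ha: "h a \<le> M" using a(1) S(3) by (intro M KC) (auto simp: S_def)
    \<comment> \<open>Compactness does not bound \<open>h\<close> on the segment from
      \<open>a\<close> to \<open>s\<close>, since \<open>a\<close> is in \<open>K\<close>. Instead,
      growth is run backwards from \<open>s\<close> to each \<open>c\<close> other than
      \<open>a\<close>; the resulting bound depends on \<open>s\<close> and serves only to secure
      boundedness.\<close>
    have bd: "h c \<le> max (h a) (h s * exp (L * norm (s - a)))" if c: "c \<in> closed_segment a s" for c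
    proof (cases "c = a")
      case False
      have cs: "closed_segment s c \<subseteq> closed_segment p s"
      proof -
        have "closed_segment a s \<subseteq> closed_segment p s"
          using a(1) by (simp add: S_def subset_closed_segment)
        with c have "c \<in> closed_segment p s" by blast
        then show ?thesis by (simp add: subset_closed_segment)
      qed
      have "locally_bdd_above h z" if z: "z \<in> closed_segment s c" for z
      proof (rule ccontr)
        assume "\<not> ?thesis"
        then have "z \<in> S" using z cs by (auto simp: S_def K_def)
        then have "dist s a \<le> dist s z" by (rule a)
        also have "\<dots> \<le> dist s c"
          using segment_bound1[OF z] by (simp add: dist_norm norm_minus_commute)
        also have "\<dots> < dist s a"
        proof -
          obtain u where u: "0 \<le> u" "u \<le> 1" "c = (1 - u) *\<^sub>R a + u *\<^sub>R s"
            using c by (auto simp: in_segment)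
          have "s - c = (1 - u) *\<^sub>R (s - a)" using u(3) by (simp add: algebra_simps)
          then have "norm (s - c) = (1 - u) * norm (s - a)" using u(2) by simp
          moreover have "u \<noteq> 0" using False u(3) by auto
          moreover have "s \<noteq> a" using False c by auto
          ultimately show ?thesis using u(1) by (simp add: dist_norm mult_less_cancel_right1)
        qed
        finally show False by simp
      qed
      then have "bdd_above (h ` closed_segment s c)" by (intro compact_bdd_above) auto
      from relatively_lipschitz_exp_growth[OF lip L nonneg this]
      have "h c \<le> h s * exp (L * norm (s - c))" .
      also have "\<dots> \<le> h s * exp (L * norm (s - a))"
        using segment_bound(2)[OF c] L nonneg
        by (intro mult_left_mono) (auto simp: norm_minus_commute intro!: mult_left_mono)
      finally show ?thesis by simp
    qed simp
    then have "bdd_above (h ` closed_segment a s)" by (auto simp: bdd_above_def)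
    \<comment> \<open>Growth now runs forwards from \<open>a\<close>, where \<open>h\<close> is at
      most \<open>M\<close>, and the bound is uniform in \<open>s\<close>.\<close>
    from relatively_lipschitz_exp_growth[OF lip L nonneg this]
    have "h s \<le> h a * exp (L * norm (a - s))" .
    also have "\<dots> \<le> M * exp (L * r)"
    proof (intro mult_mono ha)
      have "dist s a \<le> dist s p" using p by (intro a) (auto simp: S_def)
      then have "norm (a - s) \<le> r" using s by (simp add: dist_norm norm_minus_commute)
      then show "exp (L * norm (a - s)) \<le> exp (L * r)" using L by (simp add: mult_left_mono)
    qed (use \<open>0 \<le> M\<close> in auto)
    finally show ?thesis .
  qed
  then have "locally_bdd_above h p"
    unfolding locally_bdd_above_def using r by (auto intro!: exI[of _ r] bdd_aboveI2)
  with p show False by (simp add: K_def)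
qed

section \<open>Pointwise Lipschitz bounds and the size of the gradient\<close>

text \<open>One natural number serves as both Lipschitz constant and reciprocal radius, so grouping
  points by \<open>n\<close> gives a countable cover, as the Baire argument requires.\<close>

lemma differentiable_imp_Lipschitz_at:
  fixes f :: "'a::real_normed_vector \<Rightarrow> real"
  assumes "f differentiable (at x)"
  shows "\<exists>n::nat. \<forall>w. norm w \<le> 1 / real (Suc n) \<longrightarrow> \<bar>f (x + w) - f x\<bar> \<le> real (Suc n) * norm w"
proof -
  obtain f' where f': "(f has_derivative f') (at x)"
    using assms by (auto simp: differentiable_def)
  then have bl: "bounded_linear f'" by (rule has_derivative_bounded_linear)
  obtain d where d: "d > 0" "\<And>y. norm (y - x) < d \<Longrightarrow> norm (f y - f x - f' (y - x)) \<le> 1 * norm (y - x)"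
    using f' unfolding has_derivative_at_alt by (metis zero_less_one)
  obtain k where k: "\<And>w. norm (f' w) \<le> norm w * k"
    using bounded_linear.bounded[OF bl] by auto
  \<comment> \<open>The part \<open>k + 1\<close> covers the derivative and the remainder,
    \<open>1 / d\<close> the radius.\<close>
  obtain n :: nat where n: "real n \<ge> k + 1 + 1 / d"
    using real_arch_simple by blast
  have "\<bar>f (x + w) - f x\<bar> \<le> real (Suc n) * norm w" if w: "norm w \<le> 1 / real (Suc n)" for w
  proof -
    have kn: "0 \<le> norm w * k" using k[of w] norm_ge_zero order_trans by blast
    show ?thesis
    proof (cases "w = 0")
      case False
      then have k0: "0 \<le> k" using kn by (simp add: zero_le_mult_iff)
      then have "1 / d < real (Suc n)" using n by simp
      then have "1 / real (Suc n) < d" using d(1) by (simp add: field_simps)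
      with w have "norm w < d" by simp
      then have "\<bar>f (x + w) - f x - f' w\<bar> \<le> norm w" using d(2)[of "x + w"] by simp
      then have "\<bar>f (x + w) - f x\<bar> \<le> norm w * (k + 1)"
        using k[of w] by (simp add: algebra_simps)
      also have "\<dots> \<le> norm w * real (Suc n)"
      proof (rule mult_left_mono)
        have "0 < 1 / d" using d(1) by simp
        with n show "k + 1 \<le> real (Suc n)" by linarith
      qed simp
      finally show ?thesis by (simp add: mult.commute)
    qed simp
  qed
  then show ?thesis by blast
qed

lemma GDERIV_line:
  assumes "GDERIV f (x + t *\<^sub>R v) :> D"
  shows "((\<lambda>t. f (x + t *\<^sub>R v)) has_real_derivative inner v D) (at t)"
proof -
  have "((\<lambda>t. x + t *\<^sub>R v) has_derivative (\<lambda>s. s *\<^sub>R v)) (at t)"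
    by (auto intro!: derivative_eq_intros)
  from has_derivative_compose[OF this] assms
  have "((\<lambda>t. f (x + t *\<^sub>R v)) has_derivative (\<lambda>s. inner (s *\<^sub>R v) D)) (at t)"
    unfolding gderiv_def by blast
  then show ?thesis
    by (simp add: has_field_derivative_def mult.commute[of _ "inner v D"])
qed

text \<open>In the direction \<open>D\<close> itself, the difference quotients tend to the squared
  norm of \<open>D\<close> while staying below \<open>K * norm D\<close>.\<close>

lemma norm_grad_le_Lipschitz:
  assumes D: "GDERIV f x :> D" and "e > 0" and "0 \<le> K"
    and lip: "\<And>w. norm w \<le> e \<Longrightarrow> \<bar>f (x + w) - f x\<bar> \<le> K * norm w"
  shows "norm D \<le> K"
proof (cases "D = 0")
  case True
  with \<open>0 \<le> K\<close> show ?thesis by simp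
next
  case False
  have "((\<lambda>t. f (x + t *\<^sub>R D)) has_real_derivative inner D D) (at 0)"
    using D by (intro GDERIV_line) simp
  then have "((\<lambda>t. (f (x + t *\<^sub>R D) - f x) / t) \<longlongrightarrow> inner D D) (at 0)"
    by (simp add: DERIV_def)
  moreover have "\<forall>\<^sub>F t in at 0. (f (x + t *\<^sub>R D) - f x) / t \<le> K * norm D"
  proof -
    have "(f (x + t *\<^sub>R D) - f x) / t \<le> K * norm D" if "dist t 0 < e / norm D" "t \<noteq> 0" for t
    proof -
      have "norm (t *\<^sub>R D) \<le> e" using that False by (simp add: field_simps)
      from lip[OF this] have "\<bar>(f (x + t *\<^sub>R D) - f x) / t\<bar> \<le> K * norm D"
        using that(2) by (simp add: abs_divide divide_simps mult_ac)
      then show ?thesis by linarith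
    qed
    moreover have "0 < e / norm D" using \<open>e > 0\<close> False by simp
    ultimately show ?thesis unfolding eventually_at by blast
  qed
  ultimately have "inner D D \<le> K * norm D"
    by (intro tendsto_upperbound) auto
  then show ?thesis
    using False by (simp add: dot_square_norm power2_eq_square)
qed

section \<open>Gradient differences under symmetric smoothness\<close>

text \<open>Replaces the extended-real supremum by an arbitrary real upper bound, so that later
  arguments stay in the reals.\<close>

lemma symmetrically_smooth_norm_diff_le:
  assumes "symmetrically_smooth L0 L1 f" and "0 \<le> L1"
    and B: "\<And>u. u \<in> closed_segment x y \<Longrightarrow> L0 + L1 * norm (grad f u) \<le> B"
  shows "norm (grad f x - grad f y) \<le> B * norm (x - y)"
proof -
  let ?S = "SUP u\<in>closed_segment x y. ereal (norm (grad f u))"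
  have "ereal L0 + ereal L1 * ?S \<le> ereal B"
  \<comment> \<open>For \<open>L1 = 0\<close> the supremum may be infinite, but
    \<open>0 * \<infinity> = 0\<close> leaves only \<open>L0\<close>.\<close>
  proof (cases "L1 = 0")
    case True
    then show ?thesis using B[of x] by (simp flip: zero_ereal_def)
  next
    case False
    with \<open>0 \<le> L1\<close> have "0 < L1" by simp
    then have "?S \<le> ereal ((B - L0) / L1)"
      using B by (intro SUP_least) (simp add: field_simps)
    then have "ereal L1 * ?S \<le> ereal L1 * ereal ((B - L0) / L1)"
      using \<open>0 < L1\<close> by (intro ereal_mult_left_mono) auto
    also have "\<dots> = ereal (B - L0)" using False by simp
    finally have "ereal L0 + ereal L1 * ?S \<le> ereal L0 + ereal (B - L0)"
      by (rule add_left_mono)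
    then show ?thesis by simp
  qed
  then have "(ereal L0 + ereal L1 * ?S) * ereal (norm (x - y)) \<le> ereal B * ereal (norm (x - y))"
    by (intro ereal_mult_right_mono) auto
  then have "ereal (norm (grad f x - grad f y)) \<le> ereal B * ereal (norm (x - y))"
    using assms(1) unfolding symmetrically_smooth_def by (meson order_trans)
  then show ?thesis by simp
qed

text \<open>Absorbing \<open>L0\<close> into the function makes the condition homogeneous; the
  reverse triangle inequality then passes from gradients to their norms.\<close>

lemma symmetrically_smooth_relatively_lipschitz:
  assumes "symmetrically_smooth L0 L1 f" and "0 \<le> L1"
  shows "relatively_lipschitz L1 (\<lambda>x. L0 + L1 * norm (grad f x))"
  unfolding relatively_lipschitz_def
proof (intro allI impI)
  fix x y B assume "\<forall>u\<in>closed_segment x y. L0 + L1 * norm (grad f u) \<le> B"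
  then have "norm (grad f x - grad f y) \<le> B * norm (x - y)"
    by (intro symmetrically_smooth_norm_diff_le[OF assms]) auto
  then have "\<bar>norm (grad f x) - norm (grad f y)\<bar> \<le> B * norm (x - y)"
    using norm_triangle_ineq3 order_trans by blast
  then have "L1 * \<bar>norm (grad f x) - norm (grad f y)\<bar> \<le> L1 * (B * norm (x - y))"
    using assms(2) by (rule mult_left_mono)
  moreover have "\<bar>L0 + L1 * norm (grad f x) - (L0 + L1 * norm (grad f y))\<bar>
      = L1 * \<bar>norm (grad f x) - norm (grad f y)\<bar>"
    using assms(2) by (simp add: abs_mult flip: right_diff_distrib)
  ultimately show "\<bar>L0 + L1 * norm (grad f x) - (L0 + L1 * norm (grad f y))\<bar> \<le> L1 * B * norm (x - y)"
    by (simp add: mult.assoc)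
qed

lemma symmetrically_smooth_locally_bdd_above:
  fixes f :: "'a::euclidean_space \<Rightarrow> real"
  assumes diff: "\<And>x. f differentiable (at x)"
    and smooth: "symmetrically_smooth L0 L1 f" and L: "0 \<le> L0" "0 \<le> L1"
  shows "locally_bdd_above (\<lambda>x. L0 + L1 * norm (grad f x)) x"
proof (rule relatively_lipschitz_locally_bdd_above[OF
      symmetrically_smooth_relatively_lipschitz[OF smooth L(2)] L(2)])
  define C where "C n = {x. \<forall>w. norm w \<le> 1 / real (Suc n) \<longrightarrow>
    \<bar>f (x + w) - f x\<bar> \<le> real (Suc n) * norm w}" for n
  have f: "continuous_on S f" for S
    using diff by (simp add: continuous_at_imp_continuous_on differentiable_imp_continuous_within)
  have "C n = (\<Inter>w\<in>{w. norm w \<le> 1 / real (Suc n)}.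
      {x. \<bar>f (x + w) - f x\<bar> \<le> real (Suc n) * norm w})" for n
    by (auto simp: C_def)
  moreover have "closed {x. \<bar>f (x + w) - f x\<bar> \<le> real (Suc n) * norm w}" for w n
    by (intro closed_Collect_le continuous_intros f continuous_on_compose2[OF f[of UNIV]]) auto
  ultimately show "closed (C n)" for n by auto
  show "(\<Union>n. C n) = UNIV"
    using differentiable_imp_Lipschitz_at[OF diff] by (auto simp: C_def)
  show "bdd_above ((\<lambda>x. L0 + L1 * norm (grad f x)) ` C n)" for n
  proof -
    have "norm (grad f x) \<le> real (Suc n)" if "x \<in> C n" for x
      using that unfolding C_def
      by (intro norm_grad_le_Lipschitz[OF GDERIV_grad[OF diff], of "1 / real (Suc n)"]) auto
    then have "L0 + L1 * norm (grad f x) \<le> L0 + L1 * real (Suc n)" if "x \<in> C n" for x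
      using that L(2) by (simp add: mult_left_mono)
    then show ?thesis unfolding bdd_above_def by blast
  qed
qed (use L in simp)

text \<open>Exponential growth from \<open>y\<close> bounds the gradient on the whole segment, so
  the supremum turns into a quantity at one endpoint.\<close>

lemma symmetrically_smooth_norm_diff_le_exp:
  fixes f :: "'a::euclidean_space \<Rightarrow> real"
  assumes diff: "\<And>x. f differentiable (at x)"
    and smooth: "symmetrically_smooth L0 L1 f" and L: "0 \<le> L0" "0 \<le> L1"
  shows "norm (grad f x - grad f y)
    \<le> (L0 + L1 * norm (grad f y)) * exp (L1 * norm (x - y)) * norm (x - y)"
proof (rule symmetrically_smooth_norm_diff_le[OF smooth L(2)])
  fix u assume u: "u \<in> closed_segment x y"
  let ?h = "\<lambda>x. L0 + L1 * norm (grad f x)"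
  have "bdd_above (?h ` closed_segment y u)"
    using symmetrically_smooth_locally_bdd_above[OF diff smooth L]
    by (intro compact_bdd_above) auto
  then have "?h u \<le> ?h y * exp (L1 * norm (y - u))"
    using L by (intro relatively_lipschitz_exp_growth
        symmetrically_smooth_relatively_lipschitz smooth) auto
  also have "\<dots> \<le> ?h y * exp (L1 * norm (x - y))"
    using segment_bound(2)[OF u] L
    by (intro mult_left_mono) (auto simp: norm_minus_commute intro!: mult_left_mono)
  finally show "?h u \<le> ?h y * exp (L1 * norm (x - y))" .
qed

section \<open>Descent inequality and gradient step\<close>

text \<open>Along the segment, \<open>f\<close> minus its linear part and the quadratic term is
  nonincreasing, because the gradient difference bound controls its derivative.\<close>

lemma symmetrically_smooth_descent:
  fixes f :: "'a::euclidean_space \<Rightarrow> real"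
  assumes diff: "\<And>x. f differentiable (at x)"
    and smooth: "symmetrically_smooth L0 L1 f" and L: "0 \<le> L0" "0 \<le> L1"
  shows "f (x + v) \<le> f x + inner (grad f x) v
    + (L0 + L1 * norm (grad f x)) * exp (L1 * norm v) * (norm v)\<^sup>2 / 2"
proof -
  define c where "c = (L0 + L1 * norm (grad f x)) * exp (L1 * norm v) * (norm v)\<^sup>2"
  define \<psi> where "\<psi> t = f (x + t *\<^sub>R v) - t * inner v (grad f x) - c * t\<^sup>2 / 2" for t
  have "\<psi> 1 \<le> \<psi> 0"
  proof (rule DERIV_nonpos_imp_nonincreasing[of 0 1 \<psi>])
    fix t :: real assume t: "0 \<le> t" "t \<le> 1"
    define g where "g = grad f (x + t *\<^sub>R v)"
    have "(\<psi> has_real_derivative inner v g - inner v (grad f x) - c * t) (at t)"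
      unfolding \<psi>_def g_def
      by (auto intro!: derivative_eq_intros GDERIV_line GDERIV_grad diff)
    moreover have "inner v g - inner v (grad f x) - c * t \<le> 0"
    proof -
      have "inner v g - inner v (grad f x) = inner v (g - grad f x)"
        by (simp add: inner_diff_right)
      also have "\<dots> \<le> norm v * norm (g - grad f x)" by (rule norm_cauchy_schwarz)
      also have "\<dots> \<le> norm v * ((L0 + L1 * norm (grad f x)) * exp (L1 * norm v) * (t * norm v))"
      proof (rule mult_left_mono)
        have "norm (g - grad f x)
            \<le> (L0 + L1 * norm (grad f x)) * exp (L1 * (t * norm v)) * (t * norm v)"
          using symmetrically_smooth_norm_diff_le_exp[OF diff smooth L, of "x + t *\<^sub>R v" x] t
          by (simp add: g_def)
        \<comment> \<open>The exponential is frozen at its value for \<open>t = 1\<close>, which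
          keeps the bound linear in \<open>t\<close>.\<close>
        also have "\<dots> \<le> (L0 + L1 * norm (grad f x)) * exp (L1 * norm v) * (t * norm v)"
          using t L by (intro mult_right_mono mult_left_mono)
            (auto intro!: mult_left_mono mult_left_le_one_le)
        finally show "norm (g - grad f x)
            \<le> (L0 + L1 * norm (grad f x)) * exp (L1 * norm v) * (t * norm v)" .
      qed simp
      also have "\<dots> = c * t" by (simp add: c_def power2_eq_square)
      finally show ?thesis by simp
    qed
    ultimately show "\<exists>y. (\<psi> has_real_derivative y) (at t) \<and> y \<le> 0" by blast
  qed simp
  then show ?thesis
    by (simp add: \<psi>_def c_def inner_commute)
qed

text \<open>The step length \<open>\<nu> * norm g / A\<close> minimises the bound of the descent lemma
  once \<open>exp (L1 * r)\<close> is replaced by \<open>exp \<nu> = 1 / \<nu>\<close>.\<close>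

lemma symmetrically_smooth_decrease:
  fixes f :: "'a::euclidean_space \<Rightarrow> real"
  assumes diff: "\<And>x. f differentiable (at x)"
    and smooth: "symmetrically_smooth L0 L1 f" and L: "0 \<le> L0" "0 \<le> L1"
    and \<nu>: "\<nu> = exp (- \<nu>)"
    and A: "A = L0 + L1 * norm (grad f x)" "0 < A" and g: "L1 * norm g \<le> A"
  shows "\<exists>v. f (x + v) - inner (grad f x - g) v \<le> f x - \<nu> * (norm g)\<^sup>2 / (2 * A)"
proof (intro exI)
  have \<nu>0: "0 < \<nu>" by (subst \<nu>) simp
  have exp\<nu>: "exp \<nu> = 1 / \<nu>" by (subst (2) \<nu>) (simp add: exp_minus field_simps)
  \<comment> \<open>\<open>g\<close> is the gradient at \<open>x\<close> of \<open>f\<close> tilted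
    by the linear functional \<open>inner (grad f x - g)\<close>, so this is a gradient step for the
    tilted function.\<close>
  define v where "v = (- (\<nu> / A)) *\<^sub>R g"
  have nv: "norm v = \<nu> * norm g / A" using \<nu>0 A(2) by (simp add: v_def)
  have "L1 * norm v = \<nu> * (L1 * norm g / A)" by (simp add: nv)
  also have "\<dots> \<le> \<nu> * 1" using g A(2) \<nu>0 by (intro mult_left_mono) auto
  finally have "exp (L1 * norm v) \<le> 1 / \<nu>" by (simp flip: exp\<nu>)
  then have "A * exp (L1 * norm v) * (norm v)\<^sup>2 / 2 \<le> A * (1 / \<nu>) * (norm v)\<^sup>2 / 2"
    using A(2) by (intro divide_right_mono mult_right_mono mult_left_mono) auto
  also have "\<dots> = \<nu> * (norm g)\<^sup>2 / (2 * A)"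
    using A(2) \<nu>0 by (simp add: nv power2_eq_square field_simps)
  finally have "f (x + v) \<le> f x + inner (grad f x) v + \<nu> * (norm g)\<^sup>2 / (2 * A)"
    using symmetrically_smooth_descent[OF diff smooth L, of x v, folded A(1)] by linarith
  \<comment> \<open>The linear term is minus twice the quadratic one, so their sum leaves the
    claimed decrease.\<close>
  moreover have "inner g v = - 2 * (\<nu> * (norm g)\<^sup>2 / (2 * A))"
    using A(2) by (simp add: v_def dot_square_norm)
  ultimately show "f (x + v) - inner (grad f x - g) v \<le> f x - \<nu> * (norm g)\<^sup>2 / (2 * A)"
    by (simp add: inner_diff_left)
qed

section \<open>Lower bounds on the function gap and the Bregman distance\<close>

text \<open>The decrease of one gradient step with \<open>g = grad f x\<close> cannot exceed the gap
  to the infimum; the step is admissible because \<open>L0\<close> is nonnegative.\<close>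

lemma symmetrically_smooth_gradient_inf:
  fixes f :: "'a::euclidean_space \<Rightarrow> real"
  assumes diff: "\<And>x. f differentiable (at x)"
    and smooth: "symmetrically_smooth L0 L1 f" and L: "0 \<le> L0" "0 \<le> L1"
    and \<nu>: "\<nu> = exp (- \<nu>)"
  shows "equot (\<nu> * (norm (grad f x))\<^sup>2) (2 * (L0 + L1 * norm (grad f x)))
    \<le> ereal (f x) - (INF z. ereal (f z))"
proof -
  define I where "I = (INF z. ereal (f z))"
  have lower: "ereal (f x - f z) \<le> ereal (f x) - I" for z
    using ereal_minus_mono[of "ereal (f x)" "ereal (f x)" I "ereal (f z)"] INF_lower[of z UNIV "\<lambda>z. ereal (f z)"]
    by (simp add: I_def)
  define A where "A = L0 + L1 * norm (grad f x)"
  have "equot (\<nu> * (norm (grad f x))\<^sup>2) (2 * A) \<le> ereal (f x) - I"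
  proof (cases "A = 0")
    case A: True
    show ?thesis
    proof (cases "grad f x = 0")
      case True
      with A show ?thesis using lower[of x] by (simp add: equot_0_0 zero_ereal_def)
    next
      case False
      \<comment> \<open>With \<open>A = 0\<close> the descent bound is affine, so \<open>f\<close>
        is unbounded below along the negative gradient and the gap is infinite, like the quotient.
        The choice of \<open>t\<close> lowers that bound by \<open>\<bar>B\<bar>\<close>.\<close>
      have "ereal (f x) - I = \<infinity>"
      proof (rule ereal_top)
        fix B
        define t where "t = - (\<bar>B\<bar> / (norm (grad f x))\<^sup>2)"
        have "f (x + t *\<^sub>R grad f x) \<le> f x + t * (norm (grad f x))\<^sup>2"
          using symmetrically_smooth_descent[OF diff smooth L, of x "t *\<^sub>R grad f x"] A
          by (simp add: A_def dot_square_norm)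
        also have "\<dots> = f x - \<bar>B\<bar>" using False by (simp add: t_def)
        finally have "B \<le> f x - f (x + t *\<^sub>R grad f x)" by simp
        then show "ereal B \<le> ereal (f x) - I" using lower order_trans ereal_less_eq(3) by blast
      qed
      then show ?thesis by simp
    qed
  next
    case False
    then have "0 < A" using L by (simp add: A_def less_le)
    then obtain v where "f (x + v) \<le> f x - \<nu> * (norm (grad f x))\<^sup>2 / (2 * A)"
      using symmetrically_smooth_decrease[OF diff smooth L \<nu> A_def, of "grad f x"] L
      by (auto simp: A_def)
    then have "\<nu> * (norm (grad f x))\<^sup>2 / (2 * A) \<le> f x - f (x + v)" by simp
    then show ?thesis
      using lower False by (simp add: equot_real) (meson ereal_less_eq(3) order_trans)
  qed
  then show ?thesis by (simp add: A_def I_def)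
qed

text \<open>The bound comes from decreasing \<open>\<lambda>z. f z - inner (grad f x) z\<close>, which is minimal
  at \<open>x\<close>, starting from \<open>y\<close>.\<close>

lemma symmetrically_smooth_convex_bregman:
  fixes f :: "'a::euclidean_space \<Rightarrow> real"
  assumes diff: "\<And>x. f differentiable (at x)"
    and smooth: "symmetrically_smooth L0 L1 f" and L: "0 \<le> L0" "0 \<le> L1"
    and \<nu>: "\<nu> = exp (- \<nu>)" and "convex_fo f"
    and near: "L1 * norm (x - y) * exp (L1 * norm (x - y)) \<le> 1"
  shows "equot (\<nu> * (norm (grad f x - grad f y))\<^sup>2) (2 * (L0 + L1 * norm (grad f y)))
    \<le> ereal (f y - f x - inner (grad f x) (y - x))"
proof -
  have convex: "f x + inner (grad f x) (z - x) \<le> f z" for z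
    using \<open>convex_fo f\<close> by (simp add: convex_fo_def)
  define A where "A = L0 + L1 * norm (grad f y)"
  define g where "g = grad f y - grad f x"
  have g: "norm g \<le> A * exp (L1 * norm (x - y)) * norm (x - y)"
    using symmetrically_smooth_norm_diff_le_exp[OF diff smooth L, of x y]
    by (simp add: A_def g_def norm_minus_commute)
  have "0 \<le> A" using L by (simp add: A_def)
  have "equot (\<nu> * (norm g)\<^sup>2) (2 * A) \<le> ereal (f y - f x - inner (grad f x) (y - x))"
  proof (cases "A = 0")
    case True
    \<comment> \<open>A vanishing \<open>A\<close> forces \<open>g = 0\<close>, so the quotient is
      \<open>0 / 0 = 0\<close>, and convexity makes the right-hand side nonnegative.\<close>
    then show ?thesis using g convex[of y] by (simp add: equot_0_0)
  next
    case False
    with \<open>0 \<le> A\<close> have "0 < A" by simp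
    \<comment> \<open>The hypothesis \<open>near\<close> turns the gradient difference bound into
      \<open>L1 * norm g \<le> A\<close>, which the gradient step requires.\<close>
    have "L1 * norm g \<le> L1 * (A * exp (L1 * norm (x - y)) * norm (x - y))"
      using g L(2) by (rule mult_left_mono)
    also have "\<dots> = A * (L1 * norm (x - y) * exp (L1 * norm (x - y)))" by simp
    also have "\<dots> \<le> A * 1" using near \<open>0 \<le> A\<close> by (rule mult_left_mono)
    finally obtain v where v: "f (y + v) - inner (grad f y - g) v \<le> f y - \<nu> * (norm g)\<^sup>2 / (2 * A)"
      using symmetrically_smooth_decrease[OF diff smooth L \<nu> A_def \<open>0 < A\<close>, of g] by auto
    \<comment> \<open>The tangent inequality at \<open>x\<close>, evaluated at \<open>y + v\<close>,
      says that the tilted function is no smaller there than at \<open>x\<close>.\<close>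
    have "\<nu> * (norm g)\<^sup>2 / (2 * A) \<le> f y - f x - inner (grad f x) (y - x)"
      using v convex[of "y + v"] by (simp add: g_def inner_diff_right inner_add_right)
    then show ?thesis using False by (simp add: equot_real)
  qed
  then show ?thesis by (simp add: A_def g_def norm_minus_commute)
qed

theorem lemma2p2:
  fixes f :: "real ^ 'd \<Rightarrow> real" and L0 L1 \<nu> :: real
  assumes "\<forall>x. f differentiable (at x)"
    and "L0 \<ge> 0" and "L1 \<ge> 0"
    and "symmetrically_smooth L0 L1 f"
    and "\<nu> = exp (- \<nu>)"
  shows "(\<forall>x. equot (\<nu> * (norm (grad f x))\<^sup>2) (2 * (L0 + L1 * norm (grad f x)))
              \<le> ereal (f x) - (INF z. ereal (f z)))
    \<and> (convex_fo f \<longrightarrow>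
        (\<forall>x y. L1 * norm (x - y) * exp (L1 * norm (x - y)) \<le> 1 \<longrightarrow>
           equot (\<nu> * (norm (grad f x - grad f y))\<^sup>2) (2 * (L0 + L1 * norm (grad f y)))
             \<le> ereal (f y - f x - inner (grad f x) (y - x))
         \<and> equot (\<nu> * (norm (grad f x - grad f y))\<^sup>2) (2 * (L0 + L1 * norm (grad f y)))
             + equot (\<nu> * (norm (grad f x - grad f y))\<^sup>2) (2 * (L0 + L1 * norm (grad f x)))
             \<le> ereal (inner (grad f x - grad f y) (x - y))))"
proof (intro conjI allI impI)
  have diff: "\<And>x. f differentiable (at x)" using assms(1) by blast
  show "equot (\<nu> * (norm (grad f x))\<^sup>2) (2 * (L0 + L1 * norm (grad f x)))
      \<le> ereal (f x) - (INF z. ereal (f z))" for x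
    by (rule symmetrically_smooth_gradient_inf[OF diff assms(4,2,3,5)])
  fix x y :: "real ^ 'd"
  assume "convex_fo f" and near: "L1 * norm (x - y) * exp (L1 * norm (x - y)) \<le> 1"
  note bregman = symmetrically_smooth_convex_bregman[OF diff assms(4,2,3,5) \<open>convex_fo f\<close>]
  show xy: "equot (\<nu> * (norm (grad f x - grad f y))\<^sup>2) (2 * (L0 + L1 * norm (grad f y)))
      \<le> ereal (f y - f x - inner (grad f x) (y - x))"
    by (rule bregman[OF near])
  \<comment> \<open>The condition \<open>near\<close> is symmetric, so the roles of \<open>x\<close>
    and \<open>y\<close> can be exchanged; on adding both bounds the function values cancel.\<close>
  have yx: "equot (\<nu> * (norm (grad f x - grad f y))\<^sup>2) (2 * (L0 + L1 * norm (grad f x)))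
      \<le> ereal (f x - f y - inner (grad f y) (x - y))"
    using bregman[of y x] near by (simp add: norm_minus_commute)
  have "ereal (f y - f x - inner (grad f x) (y - x)) + ereal (f x - f y - inner (grad f y) (x - y))
      = ereal (inner (grad f x - grad f y) (x - y))"
    by (simp add: inner_diff_left inner_diff_right)
  with add_mono[OF xy yx]
  show "equot (\<nu> * (norm (grad f x - grad f y))\<^sup>2) (2 * (L0 + L1 * norm (grad f y)))
      + equot (\<nu> * (norm (grad f x - grad f y))\<^sup>2) (2 * (L0 + L1 * norm (grad f x)))
      \<le> ereal (inner (grad f x - grad f y) (x - y))"
    by simp
qed

end
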